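(* Let $T$ be a triangle mesh tessellating a planar region, with set of triangles $F$. Then the energy functional $\mathcal{E}$ is a concave function on the set $\mathbf{A}_T$ of angle structures of $T$.
   Context: A triangle mesh $T$ here is a finite triangulation of a compact planar region, with vertex set $V=\{1,\dots,n\}$ and set of triangles $F$; only its combinatorial structure is kept fixed. The triangle with vertices $i,j,k$ is denoted $ijk$. An angle structure assigns to each triangle $ijk\in F$ and each of its vertices a real number, where $\alpha^i_{jk}$ is the number (the "inner angle") assigned at vertex $i$ in triangle $ijk$. The set of angle structures is $$\mathbf{A}_T=\Big\{(\dots,\alpha^i_{jk},\alpha^j_{ki},\alpha^k_{ij},\dots)\in\mathbb{R}^{3|F|} : \text{for all } ijk\in F,\ \alpha^i_{jk}+\alpha^j_{ki}+\alpha^k_{ij}=\pi,\ \alpha^i_{jk}>0,\ \alpha^j_{ki}>0,\ \alpha^k_{ij}>0\Big\}.$$ The Lobachevsky function is $\Lambda(x)=-\int_0^x \ln|2\sin t|\,dt$. The energy functional $\mathcal{E}:\mathbf{A}_T\to\mathbb{R}$ is $$\mathcal{E}(A)=\sum_{ijk\in F}\big(\Lambda(\alpha^i_{jk})+\Lambda(\alpha^j_{ki})+\Lambda(\alpha^k_{ij})\big).$$ *)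

theory Defs
  imports "HOL-Analysis.Analysis" "HOL-Analysis.Finite_Function_Topology"
begin

(* A triangle is the set of its three vertex indices; p places the vertices in the plane.
   The library's triangulation demands that any two closed triangles meet in a common
   (possibly empty) face. Compactness of R follows from the finiteness of F. *)
definition triangle_mesh :: "nat \<Rightarrow> nat set set \<Rightarrow> (real^2) set \<Rightarrow> bool" where
  "triangle_mesh n F R \<longleftrightarrow>
     \<Union>F = {1..n} \<and> (\<forall>t\<in>F. card t = 3) \<and>
     (\<exists>p :: nat \<Rightarrow> real^2. inj_on p {1..n} \<and>
        (\<forall>t\<in>F. 2 simplex (convex hull (p ` t))) \<and>
        triangulation ((\<lambda>t. convex hull (p ` t)) ` F) \<and>
        (\<Union>t\<in>F. convex hull (p ` t)) = R)"

(* (t, i) is the corner of the triangle t at its vertex i; there are 3|F| of them. *)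
definition corners :: "nat set set \<Rightarrow> (nat set \<times> nat) set" where
  "corners F = (SIGMA t:F. t)"

(* R^(3|F|) is the space of finitely supported functions vanishing off the corners of F;
   lookup A (t, i) is the inner angle at i in the triangle t. *)
definition angle_structures :: "nat set set \<Rightarrow> ((nat set \<times> nat) \<Rightarrow>\<^sub>0 real) set" where
  "angle_structures F =
     {A. Poly_Mapping.keys A \<subseteq> corners F \<and>
         (\<forall>t\<in>F. (\<Sum>i\<in>t. Poly_Mapping.lookup A (t, i)) = pi \<and>
                (\<forall>i\<in>t. Poly_Mapping.lookup A (t, i) > 0))}"

(* The oriented Lebesgue integral, also correct for negative x. *)
definition Lobachevsky :: "real \<Rightarrow> real" where
  "Lobachevsky x = - (LBINT t=0..x. ln \<bar>2 * sin t\<bar>)"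

definition energy :: "nat set set \<Rightarrow> ((nat set \<times> nat) \<Rightarrow>\<^sub>0 real) \<Rightarrow> real" where
  "energy F A = (\<Sum>t\<in>F. \<Sum>i\<in>t. Lobachevsky (Poly_Mapping.lookup A (t, i)))"

end

theory Submission
  imports Defs "HOL-Real_Asymp.Real_Asymp"
begin

text \<open>
  On \<open>(0, \<pi>)\<close> the Lobachevsky function has second derivative \<open>-cot\<close>, so along a line in
  the angles of one triangle, with direction \<open>(u, v, w)\<close>, \<open>u + v + w = 0\<close>, the second derivative
  of the energy is \<open>-(u\<^sup>2 cot a + v\<^sup>2 cot b + w\<^sup>2 cot c)\<close>. As \<open>a + b + c = \<pi>\<close>, the quadratic form in
  brackets is a sum of squares divided by \<open>sin a sin b sin c\<close>. The single summands are not concave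
  (\<open>cot\<close> is negative on \<open>(\<pi>/2, \<pi>)\<close>), so the argument treats each triangle as a whole.
\<close>

section \<open>Integrability of \<open>ln |2 sin t|\<close> and the derivative of the Lobachevsky
  function\<close>

lemma le_two_sin:
  fixes t :: real
  assumes "0 \<le> t" "t \<le> 1"
  shows "t \<le> 2 * sin t"
proof -
  have "2 * sin 0 - 0 \<le> 2 * sin t - t"
  proof (rule DERIV_nonneg_imp_nondecreasing[OF assms(1)])
    fix x assume x: "0 \<le> x" "x \<le> t"
    \<comment> \<open>As \<open>1 < pi / 3\<close>, the cosine stays at least
      \<open>cos (pi / 3) = 1/2\<close> on the interval.\<close>
    have "cos (pi / 3) \<le> cos x"
      using x assms pi_gt3 by (intro cos_monotone_0_pi_le) auto
    then have "0 \<le> 2 * cos x - 1"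
      by (simp add: cos_60)
    then show "\<exists>y. ((\<lambda>x. 2 * sin x - x) has_real_derivative y) (at x) \<and> 0 \<le> y"
      by (auto intro!: exI[of _ "2 * cos x - 1"] derivative_eq_intros)
  qed
  then show ?thesis by simp
qed

text \<open>The singularity at 0 is only logarithmic: from \<open>t \<le> 2 * sin t \<le> 2\<close>
  the integrand lies between \<open>ln t \<le> 0\<close> and \<open>ln 2\<close>, hence is dominated
  by \<open>ln 2 - ln t\<close>.\<close>

lemma set_integrable_ln_sin_near_0:
  "set_integrable lborel {0<..<1} (\<lambda>t::real. ln \<bar>2 * sin t\<bar>)"
proof (rule set_integrable_bound)
  \<comment> \<open>An antiderivative of \<open>ln 2 - ln t\<close>; its finite one-sided limits at
    0 and 1 give integrability up to the singularity.\<close>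
  let ?F = "\<lambda>t::real. t * (1 + ln 2 - ln t)"
  have "set_integrable lborel (einterval (ereal 0) (ereal 1)) (\<lambda>t. ln 2 - ln t)"
  proof (rule interval_integral_FTC_nonneg(1)[where F = ?F and A = 0 and B = "1 + ln 2"])
    show "(?F has_real_derivative ln 2 - ln x) (at x)" if "ereal 0 < ereal x" "ereal x < ereal 1" for x
      using that by (auto intro!: derivative_eq_intros simp: field_simps)
    show "AE x in lborel. ereal 0 < ereal x \<longrightarrow> ereal x < ereal 1 \<longrightarrow> 0 \<le> ln 2 - ln x"
      by (auto intro!: AE_I2)
    have "(?F \<longlongrightarrow> 0) (at_right 0)"
      by real_asymp
    then show "((?F \<circ> real_of_ereal) \<longlongrightarrow> 0) (at_right (ereal 0))"
      by (simp add: ereal_tendsto_simps)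
    have "(?F \<longlongrightarrow> 1 + ln 2) (at_left 1)"
      by real_asymp
    then show "((?F \<circ> real_of_ereal) \<longlongrightarrow> 1 + ln 2) (at_left (ereal 1))"
      by (simp add: ereal_tendsto_simps)
  qed (auto intro!: continuous_intros)
  then show "set_integrable lborel {0<..<1} (\<lambda>t::real. ln 2 - ln t)"
    by simp
  show "set_borel_measurable lborel {0<..<1} (\<lambda>t::real. ln \<bar>2 * sin t\<bar>)"
    unfolding set_borel_measurable_def by measurable
  have "norm (ln \<bar>2 * sin t\<bar>) \<le> norm (ln 2 - ln t)" if "0 < t" "t < 1" for t :: real
  proof -
    have "0 < t" "t \<le> 2 * sin t"
      using that le_two_sin[of t] by auto
    moreover from this have "ln t \<le> ln (2 * sin t)"
      by simp
    moreover have "ln (2 * sin t) \<le> ln 2"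
      using \<open>0 < t\<close> \<open>t \<le> 2 * sin t\<close> sin_le_one[of t] by (subst ln_le_cancel_iff) linarith+
    moreover have "ln t \<le> 0" "0 \<le> ln (2::real)"
      using that by auto
    ultimately show ?thesis
      unfolding real_norm_def by linarith
  qed
  then show "AE t in lborel. t \<in> {0<..<1} \<longrightarrow> norm (ln \<bar>2 * sin t\<bar>) \<le> norm (ln 2 - ln t :: real)"
    by (auto intro!: AE_I2)
qed

lemma continuous_on_ln_two_sin:
  fixes a b :: real
  assumes "0 < a" "b < pi"
  shows "continuous_on {a..b} (\<lambda>t. ln \<bar>2 * sin t\<bar>)"
proof -
  have "sin t \<noteq> 0" if "t \<in> {a..b}" for t
    using sin_gt_zero[of t] that assms by auto
  then show ?thesis
    by (auto intro!: continuous_intros)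
qed

lemma set_integrable_ln_sin:
  fixes b :: real
  assumes "0 < b" "b < pi"
  shows "set_integrable lborel {0<..<b} (\<lambda>t. ln \<bar>2 * sin t\<bar>)"
proof -
  have "set_integrable lborel {1/2..b} (\<lambda>t. ln \<bar>2 * sin t\<bar>)"
    using assms by (intro borel_integrable_atLeastAtMost' continuous_on_ln_two_sin) auto
  \<comment> \<open>The two pieces overlap, so together they cover \<open>{0<..<b}\<close> for every
    \<open>b\<close>, even when the second one is empty.\<close>
  then have "set_integrable lborel ({0<..<1} \<union> {1/2..b}) (\<lambda>t. ln \<bar>2 * sin t\<bar>)"
    by (intro set_integrable_Un set_integrable_ln_sin_near_0) auto
  then show ?thesis
    by (rule set_integrable_subset) auto
qed

text \<open>The integrand is unbounded at 0, so the integral is split at a point \<open>a\<close>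
  strictly between 0 and \<open>x\<close>: the part up to \<open>a\<close> is constant, and the
  fundamental theorem applies on a compact interval where the integrand is continuous.\<close>

lemma DERIV_Lobachevsky:
  fixes x :: real
  assumes "0 < x" "x < pi"
  shows "(Lobachevsky has_real_derivative - ln (2 * sin x)) (at x)"
proof -
  let ?g = "\<lambda>t::real. ln \<bar>2 * sin t\<bar>"
  define a b where "a = x / 2" and "b = (x + pi) / 2"
  have ab: "0 < a" "a < x" "x < b" "b < pi"
    using assms by (auto simp: a_def b_def)
  have "((\<lambda>u. LBINT t=a..u. ?g t) has_vector_derivative ?g x) (at x within {a..b})"
    using ab by (intro interval_integral_FTC2 continuous_on_ln_two_sin) auto
  then have "((\<lambda>u. LBINT t=a..u. ?g t) has_real_derivative ?g x) (at x)"
    using ab by (simp add: has_real_derivative_iff_has_vector_derivative at_within_Icc_at)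
  then have "((\<lambda>u. - ((LBINT t=0..a. ?g t) + (LBINT t=a..u. ?g t))) has_real_derivative - ?g x) (at x)"
    by (auto intro!: derivative_eq_intros)
  \<comment> \<open>The splitting is needed only for \<open>u\<close> near \<open>x\<close>, which
    suffices for the derivative there.\<close>
  moreover have "eventually (\<lambda>u. u \<in> {a<..<b}) (nhds x)"
    using ab by (intro eventually_nhds_in_open) auto
  then have "eventually (\<lambda>u. Lobachevsky u = - ((LBINT t=0..a. ?g t) + (LBINT t=a..u. ?g t))) (nhds x)"
  proof eventually_elim
    case (elim u)
    then have "interval_lebesgue_integrable lborel (ereal 0) (ereal u) ?g"
      using ab set_integrable_ln_sin[of u] by (simp add: interval_lebesgue_integrable_def)
    then have "(LBINT t=ereal 0..a. ?g t) + (LBINT t=a..u. ?g t) = (LBINT t=ereal 0..u. ?g t)"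
      using elim ab by (intro interval_integral_sum) (simp add: min_def max_def)
    then show ?case
      by (simp add: Lobachevsky_def zero_ereal_def)
  qed
  ultimately have "(Lobachevsky has_real_derivative - ?g x) (at x)"
    by (subst DERIV_cong_ev[OF refl _ refl])
  then show ?thesis
    using sin_gt_zero[OF assms] by simp
qed

section \<open>Concavity on a single triangle\<close>

text \<open>Eliminating \<open>w\<close> leaves a binary form in \<open>u\<close> and
  \<open>v\<close>. The identities \<open>sin b = sin (a + c)\<close> and
  \<open>sin a = sin (b + c)\<close> turn its cotangent sums into quotients of sines; completing the
  square in \<open>u * sin b\<close> leaves the remainder
  \<open>(v * sin a * sin c)\<^sup>2\<close>.\<close>

lemma cot_quadratic_form_nonneg:
  fixes a b c u v w :: real
  assumes pos: "0 < a" "0 < b" "0 < c" and sum: "a + b + c = pi" and dir: "u + v + w = 0"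
  shows "0 \<le> u\<^sup>2 * cot a + v\<^sup>2 * cot b + w\<^sup>2 * cot c"
proof -
  have s: "0 < sin a" "0 < sin b" "0 < sin c"
    using pos sum by (auto intro!: sin_gt_zero)
  have "sin b = sin (pi - (a + c))" "sin a = sin (pi - (b + c))"
    using sum by (simp_all add: algebra_simps flip: sum)
  then have sb: "sin b = sin a * cos c + cos a * sin c" and sa: "sin a = sin b * cos c + cos b * sin c"
    by (simp_all only: sin_pi_minus sin_add)
  have w: "w = - (u + v)"
    using dir by simp
  have ac: "cot a + cot c = sin b / (sin a * sin c)"
    using s by (subst sb) (simp add: cot_def field_simps)
  have bc: "cot b + cot c = sin a / (sin b * sin c)"
    using s by (subst sa) (simp add: cot_def field_simps)
  have "u\<^sup>2 * cot a + v\<^sup>2 * cot b + w\<^sup>2 * cot c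
      = u\<^sup>2 * (cot a + cot c) + 2 * u * v * cot c + v\<^sup>2 * (cot b + cot c)"
    by (simp add: w power2_eq_square algebra_simps)
  also have "\<dots> = (u\<^sup>2 * (sin b)\<^sup>2 + 2 * u * v * cos c * sin a * sin b + v\<^sup>2 * (sin a)\<^sup>2)
      / (sin a * sin b * sin c)"
    unfolding ac bc using s by (simp add: cot_def field_simps power2_eq_square)
  also have "u\<^sup>2 * (sin b)\<^sup>2 + 2 * u * v * cos c * sin a * sin b + v\<^sup>2 * (sin a)\<^sup>2
      = (u * sin b + v * sin a * cos c)\<^sup>2 + v\<^sup>2 * (sin a)\<^sup>2 * (1 - (cos c)\<^sup>2)"
    by (simp add: power2_eq_square algebra_simps)
  also have "1 - (cos c)\<^sup>2 = (sin c)\<^sup>2"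
    by (simp add: sin_squared_eq)
  also have "0 \<le> ((u * sin b + v * sin a * cos c)\<^sup>2 + v\<^sup>2 * (sin a)\<^sup>2 * (sin c)\<^sup>2)
      / (sin a * sin b * sin c)"
    using s by (intro divide_nonneg_pos add_nonneg_nonneg mult_nonneg_nonneg mult_pos_pos) auto
  finally show ?thesis .
qed

lemma DERIV_Lobachevsky_line:
  fixes a u s :: real
  assumes "0 < a + s * u" "a + s * u < pi"
  shows "((\<lambda>s. Lobachevsky (a + s * u)) has_real_derivative - u * ln (2 * sin (a + s * u))) (at s)"
    and "((\<lambda>s. - u * ln (2 * sin (a + s * u))) has_real_derivative - u\<^sup>2 * cot (a + s * u)) (at s)"
proof -
  have "((\<lambda>s. a + s * u) has_real_derivative u) (at s)"
    by (auto intro!: derivative_eq_intros)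
  from DERIV_chain2[OF DERIV_Lobachevsky[OF assms] this]
  show "((\<lambda>s. Lobachevsky (a + s * u)) has_real_derivative - u * ln (2 * sin (a + s * u))) (at s)"
    by (simp add: mult.commute)
  show "((\<lambda>s. - u * ln (2 * sin (a + s * u))) has_real_derivative - u\<^sup>2 * cot (a + s * u)) (at s)"
    using sin_gt_zero[OF assms]
    by (auto intro!: derivative_eq_intros simp: cot_def field_simps power2_eq_square)
qed

lemma Lobachevsky_triangle_concave:
  fixes a b c a' b' c' \<mu> \<nu> :: real
  assumes pos: "0 < a" "0 < b" "0 < c" and sum: "a + b + c = pi"
    and pos': "0 < a'" "0 < b'" "0 < c'" and sum': "a' + b' + c' = pi"
    and \<mu>\<nu>: "0 \<le> \<mu>" "0 \<le> \<nu>" "\<mu> + \<nu> = 1"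
  shows "\<mu> * (Lobachevsky a + Lobachevsky b + Lobachevsky c)
       + \<nu> * (Lobachevsky a' + Lobachevsky b' + Lobachevsky c')
    \<le> Lobachevsky (\<mu> * a + \<nu> * a') + Lobachevsky (\<mu> * b + \<nu> * b') + Lobachevsky (\<mu> * c + \<nu> * c')"
proof -
  define u v w where "u = a' - a" and "v = b' - b" and "w = c' - c"
  \<comment> \<open>The sum is negated because the second-derivative criterion is stated for
    convexity. The parameters 0 and 1 correspond to the two given triples.\<close>
  define h where "h s = - (Lobachevsky (a + s * u) + Lobachevsky (b + s * v) + Lobachevsky (c + s * w))" for s
  let ?d = "\<lambda>x u s. - u * ln (2 * sin (x + s * u))"
  have pos_seg: "0 < x + s * (y - x)" if "0 < x" "0 < y" "s \<in> {0..1}" for x y s :: real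
  proof -
    have "0 < (1 - s) * x + s * y"
      using that convexD[OF convex_real_interval(3)[of 0], of x y "1 - s" s] by simp
    then show ?thesis
      by (simp add: algebra_simps)
  qed
  have dir: "u + v + w = 0"
    using sum sum' by (simp add: u_def v_def w_def)
  have seg: "0 < a + s * u" "0 < b + s * v" "0 < c + s * w"
      "(a + s * u) + (b + s * v) + (c + s * w) = pi" if "s \<in> {0..1}" for s
  proof -
    have "(a + s * u) + (b + s * v) + (c + s * w) = a + b + c + s * (u + v + w)"
      by (simp add: algebra_simps)
    then show "(a + s * u) + (b + s * v) + (c + s * w) = pi"
      by (simp add: dir sum)
  qed (use pos_seg[OF _ _ that] pos pos' in \<open>auto simp: u_def v_def w_def\<close>)
  \<comment> \<open>Three positive numbers with sum \<open>pi\<close> are each below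
    \<open>pi\<close>.\<close>
  have lt: "a + s * u < pi" "b + s * v < pi" "c + s * w < pi" if "s \<in> {0..1}" for s
    using seg[OF that] by linarith+
  note D = DERIV_Lobachevsky_line[OF seg(1) lt(1)] DERIV_Lobachevsky_line[OF seg(2) lt(2)]
    DERIV_Lobachevsky_line[OF seg(3) lt(3)]
  have "convex_on {0..1} h"
  proof (rule f''_ge0_imp_convex)
    fix s :: real assume s: "s \<in> {0..1}"
    show "(h has_real_derivative - (?d a u s + ?d b v s + ?d c w s)) (at s)"
      unfolding h_def by (intro DERIV_minus DERIV_add D s)
    show "((\<lambda>s. - (?d a u s + ?d b v s + ?d c w s)) has_real_derivative
        - (- u\<^sup>2 * cot (a + s * u) + - v\<^sup>2 * cot (b + s * v) + - w\<^sup>2 * cot (c + s * w))) (at s)"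
      by (intro DERIV_minus DERIV_add D s)
    show "0 \<le> - (- u\<^sup>2 * cot (a + s * u) + - v\<^sup>2 * cot (b + s * v) + - w\<^sup>2 * cot (c + s * w))"
      using cot_quadratic_form_nonneg[OF seg[OF s] dir] by simp
  qed simp
  \<comment> \<open>At parameter \<open>\<nu>\<close> the segment passes through the weighted mean,
    as \<open>a + \<nu> * u = \<mu> * a + \<nu> * a'\<close> and likewise for the other two
    angles.\<close>
  from convex_onD[OF this, of \<nu> 0 1] have "h \<nu> \<le> (1 - \<nu>) * h 0 + \<nu> * h 1"
    using \<mu>\<nu> by simp
  moreover have \<mu>: "\<mu> = 1 - \<nu>"
    using \<mu>\<nu> by simp
  ultimately show ?thesis
    by (simp add: \<mu> h_def u_def v_def w_def algebra_simps)
qed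

section \<open>From single triangles to the whole mesh\<close>

lemma lookup_scaleR:
  fixes A :: "'a \<Rightarrow>\<^sub>0 'b::real_vector"
  shows "Poly_Mapping.lookup (r *\<^sub>R A) x = r *\<^sub>R Poly_Mapping.lookup A x"
proof -
  \<comment> \<open>Finite support is what lets \<open>lookup\<close> recover the pointwise multiple
    from the abstract function.\<close>
  have "finite {x. r *\<^sub>R Poly_Mapping.lookup A x \<noteq> 0}"
    by (rule finite_subset[OF _ finite_lookup[of A]]) auto
  then show ?thesis
    by (simp add: scaleR_poly_mapping_def)
qed

text \<open>Concavity on a set includes convexity of that set. Here it holds because the support
  condition and the angle sums are linear constraints and the positive half-line is convex.\<close>

lemma convex_angle_structures: "convex (angle_structures F)"
proof (rule convexI)
  fix A B :: "(nat set \<times> nat) \<Rightarrow>\<^sub>0 real" and \<mu> \<nu> :: real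
  assume A: "A \<in> angle_structures F" and B: "B \<in> angle_structures F"
    and \<mu>\<nu>: "0 \<le> \<mu>" "0 \<le> \<nu>" "\<mu> + \<nu> = 1"
  let ?C = "\<mu> *\<^sub>R A + \<nu> *\<^sub>R B"
  have lookup: "Poly_Mapping.lookup ?C x = \<mu> * Poly_Mapping.lookup A x + \<nu> * Poly_Mapping.lookup B x" for x
    by (simp add: lookup_add lookup_scaleR)
  have "Poly_Mapping.keys ?C \<subseteq> Poly_Mapping.keys A \<union> Poly_Mapping.keys B"
    by (auto simp: in_keys_iff lookup)
  then have "Poly_Mapping.keys ?C \<subseteq> corners F"
    using A B by (auto simp: angle_structures_def)
  moreover have "(\<Sum>i\<in>t. Poly_Mapping.lookup ?C (t, i)) = pi" if "t \<in> F" for t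
  proof -
    have "(\<Sum>i\<in>t. Poly_Mapping.lookup ?C (t, i)) = \<mu> * pi + \<nu> * pi"
      using A B that by (simp add: angle_structures_def lookup sum.distrib flip: sum_distrib_left)
    then show ?thesis
      using \<mu>\<nu> by (simp flip: distrib_right)
  qed
  moreover have "0 < Poly_Mapping.lookup ?C (t, i)" if "t \<in> F" "i \<in> t" for t i
    using A B that \<mu>\<nu> convexD[OF convex_real_interval(3)[of 0], of "Poly_Mapping.lookup A (t, i)" "Poly_Mapping.lookup B (t, i)" \<mu> \<nu>]
    by (simp add: angle_structures_def lookup)
  ultimately show "?C \<in> angle_structures F"
    by (simp add: angle_structures_def)
qed

theorem lemma2p4:
  fixes n :: nat and F :: "nat set set" and R :: "(real^2) set"
  assumes "triangle_mesh n F R"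
  shows "concave_on (angle_structures F) (energy F)"
  unfolding concave_on_iff
proof (intro conjI convex_angle_structures ballI allI impI)
  fix A B :: "(nat set \<times> nat) \<Rightarrow>\<^sub>0 real" and \<mu> \<nu> :: real
  assume A: "A \<in> angle_structures F" and B: "B \<in> angle_structures F"
    and \<mu>\<nu>: "0 \<le> \<mu>" "0 \<le> \<nu>" "\<mu> + \<nu> = 1"
  let ?e = "\<lambda>C t. \<Sum>i\<in>t. Lobachevsky (Poly_Mapping.lookup C (t, i))"
  \<comment> \<open>The energy is a sum over triangles, so the inequality is proved for each
    triangle and then summed.\<close>
  have "\<mu> * ?e A t + \<nu> * ?e B t \<le> ?e (\<mu> *\<^sub>R A + \<nu> *\<^sub>R B) t" if t: "t \<in> F" for t
  proof -
    have "card t = 3"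
      using assms t by (simp add: triangle_mesh_def)
    then obtain i j k where ijk: "t = {i, j, k}" "i \<noteq> j" "i \<noteq> k" "j \<noteq> k"
      by (auto simp: card_3_iff)
    have sum3: "(\<Sum>l\<in>t. f l) = f i + f j + f k" for f :: "nat \<Rightarrow> real"
      using ijk by (simp add: add.assoc)
    have "0 < Poly_Mapping.lookup C (t, l)" if "C \<in> angle_structures F" "l \<in> t" for C l
      using that t by (auto simp: angle_structures_def)
    moreover have "Poly_Mapping.lookup C (t, i) + Poly_Mapping.lookup C (t, j)
        + Poly_Mapping.lookup C (t, k) = pi" if "C \<in> angle_structures F" for C
      using that t sum3[of "\<lambda>l. Poly_Mapping.lookup C (t, l)"] by (auto simp: angle_structures_def)
    moreover have "i \<in> t" "j \<in> t" "k \<in> t"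
      using ijk by auto
    ultimately show ?thesis
      unfolding sum3 lookup_add lookup_scaleR real_scaleR_def
      using A B by (intro Lobachevsky_triangle_concave \<mu>\<nu>) blast+
  qed
  then have "(\<Sum>t\<in>F. \<mu> * ?e A t + \<nu> * ?e B t) \<le> (\<Sum>t\<in>F. ?e (\<mu> *\<^sub>R A + \<nu> *\<^sub>R B) t)"
    by (rule sum_mono)
  then show "\<mu> * energy F A + \<nu> * energy F B \<le> energy F (\<mu> *\<^sub>R A + \<nu> *\<^sub>R B)"
    by (simp add: energy_def sum.distrib sum_distrib_left)
qed

end
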